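(* Let $K$ be a field containing a primitive $n$th root of unity $\beta$, let $U_n=\langle\beta\rangle\subset K^\times$, and let $r\ge 1$. For a multiset $E=\{e_0,\dots,e_r\}\subset\mathbb{Z}/n\mathbb{Z}$ of size $r+1$ put $$\mathcal M_E=\{[t^{e_0}:\cdots:t^{e_r}]: t\in U_n\}\subset\mathrm{PG}(r,K),\qquad S_E=\mathrm{diag}(\beta^{e_0},\dots,\beta^{e_r})\in\mathrm{GL}(r+1,K),$$ and call $E$ regular if $\gcd(n,\{e_i-e_0: 1\le i\le r\})=1$. Let $E=\{e_0,\dots,e_r\}$ and $F=\{f_0,\dots,f_r\}$ be regular multisets in $\mathbb{Z}/n\mathbb{Z}$ of size $r+1$. Assume there exists $P\in\mathrm{PGL}(r+1,K)$ with $P(\mathcal M_E)=\mathcal M_F$ and $P[S_E]P^{-1}\in\langle[S_F]\rangle$. Then there exist $u\in(\mathbb{Z}/n\mathbb{Z})^\times$ and $v\in\mathbb{Z}/n\mathbb{Z}$ such that $E\equiv v+uF\pmod n$ as unordered multisets in $\mathbb{Z}/n\mathbb{Z}$.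
   Context: For regular $E$, the element $[S_E]\in\mathrm{PGL}(r+1,K)$ acts on $\mathcal M_E$ via $t\mapsto\beta t$ on the parameter, and this action is regular, so $|\mathcal M_E|=n$. *)

theory Defs
  imports
    "Jordan_Normal_Form.Matrix"
    "HOL-Algebra.Coset"
    "HOL-Algebra.Generated_Groups"
    "HOL-Library.Multiset"
begin

section \<open>The groups \<open>GL(d,K)\<close> and \<open>PGL(d,K)\<close>\<close>

definition GL :: "'a::field itself \<Rightarrow> nat \<Rightarrow> 'a mat monoid" where
  "GL ty d = units_of (ring_mat ty d ())"

definition scalar_mats :: "'a::field itself \<Rightarrow> nat \<Rightarrow> 'a mat set" where
  "scalar_mats ty d = {c \<cdot>\<^sub>m 1\<^sub>m d | c. c \<noteq> 0}"

definition PGL :: "'a::field itself \<Rightarrow> nat \<Rightarrow> 'a mat set monoid" where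
  "PGL ty d = GL ty d Mod scalar_mats ty d"

definition PGL_class :: "nat \<Rightarrow> 'a::field mat \<Rightarrow> 'a mat set" where
  "PGL_class d A = scalar_mats TYPE('a) d #>\<^bsub>GL TYPE('a) d\<^esub> A"

section \<open>Points of projective space\<close>

text \<open>A point is the set of all its homogeneous coordinate vectors.\<close>

definition proj_point :: "'a::field vec \<Rightarrow> 'a vec set" where
  "proj_point x = {c \<cdot>\<^sub>v x | c. c \<noteq> 0}"

definition PG :: "'a::field itself \<Rightarrow> nat \<Rightarrow> 'a vec set set" where
  "PG ty r = proj_point ` (carrier_vec (r + 1) - {0\<^sub>v (r + 1)})"

definition PGL_act :: "'a::field mat set \<Rightarrow> 'a vec set \<Rightarrow> 'a vec set" where
  "PGL_act P p = {A *\<^sub>v x | A x. A \<in> P \<and> x \<in> p}"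

section \<open>Monomial orbits\<close>

definition primitive_root_of_unity :: "nat \<Rightarrow> 'a::field \<Rightarrow> bool" where
  "primitive_root_of_unity n b \<longleftrightarrow>
     n > 0 \<and> b ^ n = 1 \<and> (\<forall>k. 0 < k \<and> k < n \<longrightarrow> b ^ k \<noteq> 1)"

definition cyclic_units :: "'a::field \<Rightarrow> 'a set" where
  "cyclic_units b = range (\<lambda>k::int. b powi k)"

text \<open>A family of residues modulo \<open>n\<close> is given by integer representatives
  \<open>e 0, \<dots>, e r\<close>; values of \<open>e\<close> at indices above \<open>r\<close> are irrelevant. Elements of
  \<open>\<int>/n\<int>\<close> are compared through their canonical representatives in \<open>{0..<n}\<close>.\<close>

definition residue_mset :: "nat \<Rightarrow> nat \<Rightarrow> (nat \<Rightarrow> int) \<Rightarrow> int multiset" where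
  "residue_mset n r e = image_mset (\<lambda>i. e i mod int n) (mset_set {0..r})"

definition monomial_set :: "'a::field \<Rightarrow> nat \<Rightarrow> (nat \<Rightarrow> int) \<Rightarrow> 'a vec set set" where
  "monomial_set b r e =
     {proj_point (vec (r + 1) (\<lambda>i. t powi e i)) | t. t \<in> cyclic_units b}"

definition S_mat :: "'a::field \<Rightarrow> nat \<Rightarrow> (nat \<Rightarrow> int) \<Rightarrow> 'a mat" where
  "S_mat b r e = mat_diag (r + 1) (\<lambda>i. b powi e i)"

definition regular_family :: "nat \<Rightarrow> nat \<Rightarrow> (nat \<Rightarrow> int) \<Rightarrow> bool" where
  "regular_family n r e \<longleftrightarrow> Gcd (insert (int n) ((\<lambda>i. e i - e 0) ` {1..r})) = 1"

section \<open>Basic facts about the encodings\<close>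

lemma group_GL: "group (GL TYPE('a::field) d)"
proof -
  interpret ring "ring_mat TYPE('a) d ()" by (rule ring_mat)
  show ?thesis unfolding GL_def by (rule units_group)
qed

lemma carrier_GL:
  "carrier (GL TYPE('a::field) d) =
     {A \<in> carrier_mat d d. \<exists>B \<in> carrier_mat d d. B * A = 1\<^sub>m d \<and> A * B = 1\<^sub>m d}"
  by (simp add: GL_def units_of_def Units_def ring_mat_def)

lemma mult_GL: "A \<otimes>\<^bsub>GL ty d\<^esub> B = A * B"
  by (simp add: GL_def units_of_def ring_mat_def)

lemma one_GL: "\<one>\<^bsub>GL ty d\<^esub> = 1\<^sub>m d"
  by (simp add: GL_def units_of_def ring_mat_def)

lemma scalar_mats_normal: "scalar_mats TYPE('a::field) d \<lhd> GL TYPE('a) d"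
proof -
  let ?G = "GL TYPE('a) d" and ?Z = "scalar_mats TYPE('a) d"
  interpret group ?G by (rule group_GL)
  have mul: "(c \<cdot>\<^sub>m 1\<^sub>m d) * (c' \<cdot>\<^sub>m 1\<^sub>m d) = (c * c') \<cdot>\<^sub>m (1\<^sub>m d :: 'a mat)" for c c' :: 'a
    by (rule eq_matI) auto
  have inG: "c \<cdot>\<^sub>m 1\<^sub>m d \<in> carrier ?G" if "c \<noteq> 0" for c :: 'a
    using that by (auto simp: carrier_GL mul intro!: bexI[of _ "inverse c \<cdot>\<^sub>m 1\<^sub>m d"])
  have inv: "inv\<^bsub>?G\<^esub> (c \<cdot>\<^sub>m 1\<^sub>m d) = inverse c \<cdot>\<^sub>m 1\<^sub>m d" if "c \<noteq> 0" for c :: 'a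
  proof (rule inv_equality)
    show "(inverse c \<cdot>\<^sub>m 1\<^sub>m d) \<otimes>\<^bsub>?G\<^esub> (c \<cdot>\<^sub>m 1\<^sub>m d) = \<one>\<^bsub>?G\<^esub>"
      using that by (auto simp: mult_GL one_GL mul intro!: eq_matI)
  qed (use that inG in auto)
  have sub: "subgroup ?Z ?G"
  proof (rule subgroupI)
    show "?Z \<subseteq> carrier ?G" using inG by (auto simp: scalar_mats_def)
    show "?Z \<noteq> {}" unfolding scalar_mats_def using one_neq_zero by blast
    show "inv\<^bsub>?G\<^esub> a \<in> ?Z" if "a \<in> ?Z" for a
    proof -
      from that obtain c where "a = c \<cdot>\<^sub>m 1\<^sub>m d" "c \<noteq> 0" by (auto simp: scalar_mats_def)
      then show ?thesis
        using inv[of c] nonzero_imp_inverse_nonzero[of c] unfolding scalar_mats_def by blast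
    qed
    show "a \<otimes>\<^bsub>?G\<^esub> b \<in> ?Z" if "a \<in> ?Z" "b \<in> ?Z" for a b
    proof -
      from that obtain c c' where "a = c \<cdot>\<^sub>m 1\<^sub>m d" "c \<noteq> 0" "b = c' \<cdot>\<^sub>m 1\<^sub>m d" "c' \<noteq> 0"
        by (auto simp: scalar_mats_def)
      then show ?thesis
        using mul[of c c'] no_zero_divisors[of c c'] unfolding scalar_mats_def mult_GL by blast
    qed
  qed
  have comm: "x * (c \<cdot>\<^sub>m 1\<^sub>m d) = (c \<cdot>\<^sub>m 1\<^sub>m d) * x" if "x \<in> carrier_mat d d" for x and c :: 'a
    using that by (simp add: mult_smult_distrib[of _ d d _ d] mult_smult_assoc_mat[of _ d d _ d])
  show ?thesis
  proof (rule normalI[OF sub], intro ballI)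
    fix x assume "x \<in> carrier ?G"
    then have x: "x \<in> carrier_mat d d" by (simp add: carrier_GL)
    show "?Z #>\<^bsub>?G\<^esub> x = x <#\<^bsub>?G\<^esub> ?Z"
      using comm[OF x] by (force simp: r_coset_def l_coset_def mult_GL scalar_mats_def)
  qed
qed

lemma group_PGL: "group (PGL TYPE('a::field) d)"
  unfolding PGL_def by (rule normal.factorgroup_is_group[OF scalar_mats_normal])

lemma S_mat_in_GL:
  fixes b :: "'a::field"
  assumes "b \<noteq> 0"
  shows "S_mat b r e \<in> carrier (GL TYPE('a) (r + 1))"
proof -
  let ?B = "mat_diag (r + 1) (\<lambda>i. b powi (- e i))"
  have "?B * S_mat b r e = 1\<^sub>m (r + 1)" "S_mat b r e * ?B = 1\<^sub>m (r + 1)"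
    using assms by (simp_all add: S_mat_def power_int_minus)
  then show ?thesis unfolding carrier_GL
    by (auto simp: S_mat_def intro!: bexI[of _ ?B])
qed

lemma monomial_set_subset_PG:
  fixes b :: "'a::field"
  assumes "b \<noteq> 0"
  shows "monomial_set b r e \<subseteq> PG TYPE('a) r"
proof -
  have "vec (r + 1) (\<lambda>i. t powi e i) \<noteq> 0\<^sub>v (r + 1)" if "t \<in> cyclic_units b" for t
  proof
    assume "vec (r + 1) (\<lambda>i. t powi e i) = 0\<^sub>v (r + 1)"
    then have "vec (r + 1) (\<lambda>i. t powi e i) $ 0 = 0\<^sub>v (r + 1) $ 0" by simp
    then show False using that assms by (auto simp: cyclic_units_def)
  qed
  then show ?thesis by (auto simp: monomial_set_def PG_def)
qed

lemma PGL_act_proj_point: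
  fixes A :: "'a::field mat"
  assumes A: "A \<in> carrier_mat d d" and x: "x \<in> carrier_vec d"
  shows "PGL_act (PGL_class d A) (proj_point x) = proj_point (A *\<^sub>v x)"
proof -
  have cls: "PGL_class d A = {c \<cdot>\<^sub>m A | c. c \<noteq> 0}"
    using A by (auto simp: PGL_class_def r_coset_def scalar_mats_def mult_GL
        mult_smult_assoc_mat[of _ d d _ d])
  have act: "(c \<cdot>\<^sub>m A) *\<^sub>v (c' \<cdot>\<^sub>v x) = (c * c') \<cdot>\<^sub>v (A *\<^sub>v x)" for c c' :: 'a
    using A x by (intro eq_vecI) (auto simp: mult.assoc)
  show ?thesis
  proof
    show "PGL_act (PGL_class d A) (proj_point x) \<subseteq> proj_point (A *\<^sub>v x)"
      unfolding cls using act by (fastforce simp: PGL_act_def proj_point_def)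
    show "proj_point (A *\<^sub>v x) \<subseteq> PGL_act (PGL_class d A) (proj_point x)"
    proof
      fix y assume "y \<in> proj_point (A *\<^sub>v x)"
      then obtain c where "c \<noteq> 0" "y = c \<cdot>\<^sub>v (A *\<^sub>v x)" by (auto simp: proj_point_def)
      then have "y = (c \<cdot>\<^sub>m A) *\<^sub>v (1 \<cdot>\<^sub>v x)" "c \<noteq> 0" using act[of c 1] by simp_all
      then show "y \<in> PGL_act (PGL_class d A) (proj_point x)"
        unfolding cls PGL_act_def proj_point_def using one_neq_zero by blast
    qed
  qed
qed

end

theory Submission
  imports Defs "Jordan_Normal_Form.Char_Poly"
begin

text \<open>Lifting \<open>P\<close> to a matrix \<open>A\<close>, the conjugacy hypothesis says that \<open>S_E\<close> is similar to
  \<open>c S_F^k\<close> for some scalar \<open>c \<noteq> 0\<close> and some integer \<open>k\<close>. Comparing the eigenvalues of these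
  diagonal matrices forces \<open>c = \<beta>^v\<close> and \<open>E = v + k F\<close> as multisets modulo \<open>n\<close>. Any common divisor
  of \<open>k\<close> and \<open>n\<close> then divides all differences \<open>e i - e 0\<close>, so regularity of \<open>E\<close> makes \<open>k\<close> a unit.\<close>

text \<open>The order at \<open>a\<close> is additive over products, and a linear factor contributes
  only at its own root. A multiset can thus be read off from its product of linear factors,
  multiplicities included.\<close>

lemma order_prod_mset_linear:
  fixes M :: "'a::field multiset"
  shows "order a (\<Prod>x\<in>#M. [:- x, 1:]) = count M a"
proof (induction M)
  case empty
  show ?case by (simp add: order_0I)
next
  case (add x M)
  have nz: "(\<Prod>x\<in>#M. [:- x, 1:]) \<noteq> (0 :: 'a poly)"
    by (auto simp: prod_mset_zero_iff)
  \<comment> \<open>For \<open>x = a\<close> this is the first power of the linear factor at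
    \<open>a\<close>; otherwise \<open>a\<close> is not a root.\<close>
  have lin: "order a [:- x, 1:] = (if x = a then 1 else 0)"
    using order_power_n_n[of a 1] by (auto simp: order_0I)
  have "[:- x, 1:] * (\<Prod>x\<in>#M. [:- x, 1:]) \<noteq> (0 :: 'a poly)"
    using nz by (metis mult_eq_0_iff one_neq_zero pCons_eq_0_iff)
  from order_mult[OF this, of a]
  have "order a (\<Prod>x\<in>#add_mset x M. [:- x, 1:]) = (if x = a then 1 else 0) + count M a"
    unfolding image_mset_add_mset prod_mset.add_mset lin add.IH .
  also have "\<dots> = count (add_mset x M) a" by simp
  finally show ?case .
qed

text \<open>Similar matrices share their characteristic polynomial. A diagonal matrix is upper
  triangular, so this polynomial is the product of linear factors over the diagonal, and its root
  multiplicities give back the multiset of entries.\<close>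

lemma similar_mat_diag_imp_image_mset_eq:
  fixes g h :: "nat \<Rightarrow> 'a::field"
  assumes "similar_mat (mat_diag d g) (mat_diag d h)"
  shows "image_mset g (mset_set {0..<d}) = image_mset h (mset_set {0..<d})"
proof -
  have cp: "char_poly (mat_diag d g) = (\<Prod>x\<in>#image_mset g (mset_set {0..<d}). [:- x, 1:])"
    for g :: "nat \<Rightarrow> 'a"
  proof -
    have "char_poly (mat_diag d g) = (\<Prod>a\<leftarrow>diag_mat (mat_diag d g). [:- a, 1:])"
      by (rule char_poly_upper_triangular[of _ d]) (auto simp: mat_diag_def)
    also have "diag_mat (mat_diag d g) = map g [0..<d]"
      by (auto simp: diag_mat_def mat_diag_def)
    also have "(\<Prod>a\<leftarrow>map g [0..<d]. [:- a, 1:]) =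
        prod_mset (mset (map (\<lambda>a. [:- a, 1:]) (map g [0..<d])))"
      by (rule prod_mset_prod_list[symmetric])
    finally show ?thesis by (simp add: multiset.map_comp comp_def)
  qed
  have "(\<Prod>x\<in>#image_mset g (mset_set {0..<d}). [:- x, 1:]) =
      (\<Prod>x\<in>#image_mset h (mset_set {0..<d}). [:- x, 1:])"
    using char_poly_similar[OF assms] unfolding cp .
  then show ?thesis
    by (intro multiset_eqI) (metis order_prod_mset_linear)
qed

text \<open>Division with remainder reduces any integer exponent to one in \<open>{0..<n}\<close>,
  where primitivity leaves 0 as the only exponent with power 1. Equality of two powers reduces to
  this case by taking the quotient.\<close>

lemma primitive_root_powi_eq_iff:
  assumes "primitive_root_of_unity n b"
  shows "b powi x = b powi y \<longleftrightarrow> x mod int n = y mod int n"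
proof -
  from assms have n: "n > 0" and bn: "b ^ n = 1"
    and prim: "\<And>k. 0 < k \<Longrightarrow> k < n \<Longrightarrow> b ^ k \<noteq> 1"
    by (auto simp: primitive_root_of_unity_def)
  have b0: "b \<noteq> 0" using n bn by (metis power_eq_0_iff zero_neq_one)
  have one: "b powi z = 1 \<longleftrightarrow> int n dvd z" for z
  proof -
    have "b powi z = b powi (int n * (z div int n) + z mod int n)" by simp
    also have "\<dots> = (b powi int n) powi (z div int n) * b powi (z mod int n)"
      by (subst power_int_add) (simp_all add: b0 power_int_mult)
    also have "\<dots> = b ^ nat (z mod int n)"
      using n bn by (simp add: power_int_def)
    finally have z: "b powi z = b ^ nat (z mod int n)" .
    have "nat (z mod int n) < n" using n by (simp add: nat_less_iff)
    then have "b ^ nat (z mod int n) = 1 \<longleftrightarrow> nat (z mod int n) = 0"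
      using prim[of "nat (z mod int n)"] by (cases "nat (z mod int n) = 0") auto
    then show ?thesis unfolding z using n
      by (simp add: dvd_eq_mod_eq_0) (metis antisym_conv of_nat_0_less_iff pos_mod_sign)
  qed
  have "b powi x = b powi y \<longleftrightarrow> b powi (x - y) = 1"
    using b0 by (simp add: power_int_diff)
  then show ?thesis by (simp add: one mod_eq_dvd_iff)
qed

lemma S_mat_int_pow:
  fixes b :: "'a::field"
  assumes b: "b \<noteq> 0"
  shows "S_mat b r e [^]\<^bsub>GL TYPE('a) (r + 1)\<^esub> (k::int) = S_mat b r (\<lambda>i. k * e i)"
proof -
  let ?G = "GL TYPE('a) (r + 1)"
  interpret group ?G by (rule group_GL)
  have mult: "S_mat b r g \<otimes>\<^bsub>?G\<^esub> S_mat b r h = S_mat b r (\<lambda>i. g i + h i)" for g h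
    using b by (simp add: mult_GL S_mat_def power_int_add)
  have one: "S_mat b r (\<lambda>i. 0) = \<one>\<^bsub>?G\<^esub>"
    by (simp add: S_mat_def one_GL)
  have pow: "S_mat b r e [^]\<^bsub>?G\<^esub> m = S_mat b r (\<lambda>i. int m * e i)" for m :: nat
    by (induction m) (simp_all add: one mult[simplified] algebra_simps)
  have inv: "inv\<^bsub>?G\<^esub> (S_mat b r g) = S_mat b r (\<lambda>i. - g i)" for g
    by (rule inv_equality) (simp_all add: mult[simplified] one[simplified] S_mat_in_GL[OF b, simplified])
  show ?thesis
    unfolding int_pow_def2 pow inv by (cases "k < 0") simp_all
qed

text \<open>A cyclic subgroup consists of the integer powers of its generator, which yields
  \<open>k\<close>. Lifting the resulting equation from \<open>PGL\<close> to \<open>GL\<close>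
  costs a scalar matrix, which yields \<open>c\<close>.\<close>

lemma PGL_conjugate_imp_similar:
  fixes S T :: "'a::field mat"
  assumes S: "S \<in> carrier (GL TYPE('a) d)" and T: "T \<in> carrier (GL TYPE('a) d)"
    and P: "P \<in> carrier (PGL TYPE('a) d)"
    and conj: "P \<otimes>\<^bsub>PGL TYPE('a) d\<^esub> PGL_class d S \<otimes>\<^bsub>PGL TYPE('a) d\<^esub> inv\<^bsub>PGL TYPE('a) d\<^esub> P
      \<in> generate (PGL TYPE('a) d) {PGL_class d T}"
  obtains c and k :: int where "c \<noteq> 0"
    and "similar_mat (c \<cdot>\<^sub>m (T [^]\<^bsub>GL TYPE('a) d\<^esub> k)) S"
proof -
  let ?G = "GL TYPE('a) d" and ?H = "PGL TYPE('a) d" and ?Z = "scalar_mats TYPE('a) d"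
  interpret G: group ?G by (rule group_GL)
  interpret H: group ?H by (rule group_PGL)
  interpret Z: normal ?Z ?G by (rule scalar_mats_normal)
  \<comment> \<open>The quotient map is a homomorphism, so products, inverses and powers of classes
    can be computed on representatives.\<close>
  interpret group_hom ?G ?H "PGL_class d"
    using Z.r_coset_hom_Mod
    by unfold_locales (simp add: PGL_def PGL_class_def[abs_def])
  obtain A where A: "A \<in> carrier ?G" and PA: "P = PGL_class d A"
    using P by (auto simp: PGL_def FactGroup_def RCOSETS_def PGL_class_def)
  let ?B = "inv\<^bsub>?G\<^esub> A"
  obtain k :: int where "PGL_class d (A \<otimes>\<^bsub>?G\<^esub> S \<otimes>\<^bsub>?G\<^esub> ?B) = PGL_class d T [^]\<^bsub>?H\<^esub> k"
    using conj A S T by (auto simp: H.generate_pow PA)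
  also have "\<dots> = PGL_class d (T [^]\<^bsub>?G\<^esub> k)"
    using T by (simp add: hom_int_pow)
  \<comment> \<open>Equal classes are equal cosets, and a representative lies in its own
    coset.\<close>
  finally have "A \<otimes>\<^bsub>?G\<^esub> S \<otimes>\<^bsub>?G\<^esub> ?B \<in> ?Z #>\<^bsub>?G\<^esub> (T [^]\<^bsub>?G\<^esub> k)"
    unfolding PGL_class_def using G.rcos_self[OF _ Z.subgroup_axioms] A S by (metis G.inv_closed G.m_closed)
  then obtain c where c: "c \<noteq> 0" and AS: "A * S * ?B = c \<cdot>\<^sub>m 1\<^sub>m d * (T [^]\<^bsub>?G\<^esub> k)"
    by (auto simp: r_coset_def scalar_mats_def mult_GL)
  have Tk: "T [^]\<^bsub>?G\<^esub> k \<in> carrier_mat d d"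
    using G.int_pow_closed[OF T] by (simp add: carrier_GL)
  have AS': "A * S * ?B = c \<cdot>\<^sub>m (T [^]\<^bsub>?G\<^esub> k)"
    unfolding AS using Tk by (simp add: mult_smult_assoc_mat[of _ d d _ d])
  have mats: "A \<in> carrier_mat d d" "?B \<in> carrier_mat d d" "S \<in> carrier_mat d d"
    using A S G.inv_closed[OF A] by (simp_all add: carrier_GL)
  have "similar_mat_wit (c \<cdot>\<^sub>m (T [^]\<^bsub>?G\<^esub> k)) S A ?B"
    using mats Tk G.r_inv[OF A] G.l_inv[OF A] AS'
    by (auto simp: similar_mat_wit_def Let_def mult_GL one_GL)
  then show ?thesis using c that unfolding similar_mat_def by blast
qed

theorem theorem5p2:
  fixes \<beta> :: "'a::field" and n r :: nat and e f :: "nat \<Rightarrow> int"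
  assumes "primitive_root_of_unity n \<beta>"
    and "r \<ge> 1"
    and "regular_family n r e"
    and "regular_family n r f"
    and "\<exists>P \<in> carrier (PGL TYPE('a) (r + 1)).
           PGL_act P ` monomial_set \<beta> r e = monomial_set \<beta> r f \<and>
           P \<otimes>\<^bsub>PGL TYPE('a) (r + 1)\<^esub> PGL_class (r + 1) (S_mat \<beta> r e)
             \<otimes>\<^bsub>PGL TYPE('a) (r + 1)\<^esub> inv\<^bsub>PGL TYPE('a) (r + 1)\<^esub> P
           \<in> generate (PGL TYPE('a) (r + 1)) {PGL_class (r + 1) (S_mat \<beta> r f)}"
  shows "\<exists>u v :: int. coprime u (int n) \<and>
           residue_mset n r e =
             image_mset (\<lambda>x. (v + u * x) mod int n) (residue_mset n r f)"
proof -
  have "\<beta> ^ n = 1" "n > 0" using assms(1) by (auto simp: primitive_root_of_unity_def)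
  then have \<beta>: "\<beta> \<noteq> 0" by (metis power_eq_0_iff zero_neq_one)
  have ran: "{0..<r + 1} = {0..r}" by auto
  let ?M = "mset_set {0..r}"
  obtain c and k :: int where c: "c \<noteq> 0"
    and "similar_mat (c \<cdot>\<^sub>m (S_mat \<beta> r f [^]\<^bsub>GL TYPE('a) (r + 1)\<^esub> k)) (S_mat \<beta> r e)"
    using assms(5) PGL_conjugate_imp_similar[OF S_mat_in_GL[OF \<beta>] S_mat_in_GL[OF \<beta>]] by metis
  moreover have "c \<cdot>\<^sub>m S_mat \<beta> r (\<lambda>i. k * f i) = mat_diag (r + 1) (\<lambda>i. c * \<beta> powi (k * f i))"
    by (rule eq_matI) (auto simp: S_mat_def mat_diag_def)
  ultimately have "similar_mat (mat_diag (r + 1) (\<lambda>i. c * \<beta> powi (k * f i)))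
      (mat_diag (r + 1) (\<lambda>i. \<beta> powi e i))"
    by (simp only: S_mat_int_pow[OF \<beta>]) (simp only: S_mat_def)
  from similar_mat_diag_imp_image_mset_eq[OF this]
  have eig: "image_mset (\<lambda>i. c * \<beta> powi (k * f i)) ?M = image_mset (\<lambda>i. \<beta> powi e i) ?M"
    by (simp only: ran)
  \<comment> \<open>A single common eigenvalue suffices to express \<open>c\<close> as a power of
    \<beta>.\<close>
  have "\<beta> powi e 0 \<in># image_mset (\<lambda>i. c * \<beta> powi (k * f i)) ?M"
    unfolding eig by auto
  then obtain j where "\<beta> powi e 0 = c * \<beta> powi (k * f j)" by auto
  then have cv: "c = \<beta> powi (e 0 - k * f j)" using \<beta> by (simp add: power_int_diff)
  define v where "v = e 0 - k * f j"
  \<comment> \<open>A discrete logarithm to base \<beta>. The exponent picked by \<open>SOME\<close>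
    is arbitrary, but its residue modulo \<open>n\<close> is not. Mapping \<open>L\<close> over the
    eigenvalues turns them into residues.\<close>
  define L where "L y = (SOME x. \<beta> powi x = y) mod int n" for y
  have L: "L (\<beta> powi x) = x mod int n" for x
    unfolding L_def
    using someI[of "\<lambda>z. \<beta> powi z = \<beta> powi x" x] primitive_root_powi_eq_iff[OF assms(1)] by blast
  have "image_mset (\<lambda>i. \<beta> powi e i) ?M = image_mset (\<lambda>i. \<beta> powi (v + k * f i)) ?M"
    using \<beta> by (simp add: eig[symmetric] cv v_def power_int_add)
  then have "image_mset L (image_mset (\<lambda>i. \<beta> powi e i) ?M) =
      image_mset L (image_mset (\<lambda>i. \<beta> powi (v + k * f i)) ?M)"
    by simp
  then have main: "image_mset (\<lambda>i. e i mod int n) ?M = image_mset (\<lambda>i. (v + k * f i) mod int n) ?M"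
    by (simp add: multiset.map_comp comp_def L)
  \<comment> \<open>\<open>residue_mset\<close> holds reduced representatives, so the affine map is
    applied to \<open>f i mod int n\<close> instead of \<open>f i\<close>.\<close>
  have "(v + k * (x mod int n)) mod int n = (v + k * x) mod int n" for x
    by (metis mod_add_right_eq mod_mult_right_eq)
  then have "residue_mset n r e = image_mset (\<lambda>x. (v + k * x) mod int n) (residue_mset n r f)"
    by (simp add: residue_mset_def main multiset.map_comp comp_def)
  moreover have "coprime k (int n)"
  proof (rule coprimeI)
    fix d assume dk: "d dvd k" and dn: "d dvd int n"
    \<comment> \<open>Modulo \<open>d\<close> the term \<open>k * f l\<close> vanishes, so all
      \<open>e i\<close> are congruent to the same \<open>v\<close>; subtracting the case of index 0
      then eliminates \<open>v\<close>.\<close>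
    have ev: "d dvd e i - v" if "i \<le> r" for i
    proof -
      have "e i mod int n \<in># image_mset (\<lambda>i. e i mod int n) ?M" using that by auto
      then obtain l where "e i mod int n = (v + k * f l) mod int n" unfolding main by auto
      then have "d dvd e i - (v + k * f l)"
        using dn by (metis dvd_trans mod_eq_dvd_iff)
      then have "d dvd (e i - (v + k * f l)) + k * f l" using dk by (metis dvd_add dvd_mult2)
      then show ?thesis by (simp add: algebra_simps)
    qed
    have "d dvd e i - e 0" if "i \<le> r" for i
      using dvd_diff[OF ev[OF that] ev[of 0]] by simp
    then have "d dvd Gcd (insert (int n) ((\<lambda>i. e i - e 0) ` {1..r}))"
      using dn by (intro Gcd_greatest) auto
    then show "is_unit d" using assms(3) by (simp only: regular_family_def)
  qed
  ultimately show ?thesis by blast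
qed

end
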